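(* Let $(\gamma_k)_{k\ge 0}$ be a sequence of complex numbers, let $\phi(x)=\sum_{k=0}^\infty \frac{\gamma_k}{k!}x^k$, and for every integer $n\ge 0$ let $P_n(x)=\phi(D)x^n$. Then $\{P_n(x)\}_{n=0}^\infty$ is an orthogonal polynomial sequence if and only if $\phi(x)=\gamma_0 e^{-\frac{\alpha}{2}x^2-\beta x}$ for some $\alpha,\beta\in\mathbb{C}$ with $\alpha\neq 0$ and with $\gamma_0\neq 0$. Furthermore, in this case the $P_n(x)$ satisfy the recurrence relation $$P_n(x)=(x-\beta)P_{n-1}(x)-\alpha(n-1)P_{n-2}(x)\quad (n\ge 1),\qquad P_0(x)=\gamma_0,\qquad P_{-1}(x)=0.$$
   Context: $D$ denotes differentiation with respect to $x$. The series $\phi$ is a formal power series with complex coefficients, and $\phi(D)$ is the linear operator on $\mathbb{C}[x]$ given by $\phi(D)f=\sum_{k=0}^\infty \frac{\gamma_k}{k!}f^{(k)}$ (a finite sum for each polynomial $f$). A moment functional is a linear functional $\mathcal{L}:\mathbb{C}[x]\to\mathbb{C}$. A sequence $\{P_n(x)\}_{n=0}^\infty$ of polynomials in $\mathbb{C}[x]$ is an orthogonal polynomial sequence (OPS) if there is a moment functional $\mathcal{L}$ such that for all nonnegative integers $m,n$: (i) $P_n$ has degree exactly $n$; (ii) $\mathcal{L}[P_m(x)P_n(x)]=0$ for $m\ne n$; (iii) $\mathcal{L}[P_n(x)^2]\neq 0$. An OPS is not assumed to be monic. *)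

theory Defs
  imports "HOL-Computational_Algebra.Computational_Algebra"
begin

text \<open>The operator \<open>\<phi>(D)\<close> on polynomials. The coefficient of \<open>D^k\<close> is the \<open>k\<close>-th coefficient of \<open>\<phi>\<close>
  (so \<open>\<gamma>\<^sub>k / k!\<close> for \<open>\<phi>(x) = \<Sum>k. \<gamma>\<^sub>k / k! x^k\<close>); the sum stops at \<open>degree f\<close> because all higher
  derivatives of \<open>f\<close> vanish.\<close>

definition fps_diff_op :: "complex fps \<Rightarrow> complex poly \<Rightarrow> complex poly" where
  "fps_diff_op \<phi> f = (\<Sum>k\<le>degree f. smult (fps_nth \<phi> k) ((pderiv ^^ k) f))"

definition moment_functional :: "(complex poly \<Rightarrow> complex) \<Rightarrow> bool" where
  "moment_functional L \<longleftrightarrow> Vector_Spaces.linear smult (*) L"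

text \<open>\<open>P n \<noteq> 0\<close> is required separately because \<open>degree 0 = 0\<close>.\<close>

definition is_OPS :: "(nat \<Rightarrow> complex poly) \<Rightarrow> bool" where
  "is_OPS P \<longleftrightarrow> (\<exists>L. moment_functional L \<and>
     (\<forall>m n. (P n \<noteq> 0 \<and> degree (P n) = n) \<and>
            (m \<noteq> n \<longrightarrow> L (P m * P n) = 0) \<and>
            L ((P n)\<^sup>2) \<noteq> 0))"

end

theory Submission
  imports Defs
begin

text \<open>Write \<open>P\<^sub>n = \<phi>(D)x\<^sup>n\<close>. For any \<open>\<alpha>\<close>, \<open>\<beta>\<close> the defect
  \<open>P\<^sub>n\<^sub>+\<^sub>1 - (x - \<beta>)P\<^sub>n + \<alpha>P\<^sub>n'\<close> equals \<open>\<psi>(D)x\<^sup>n\<close>, where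
  \<open>\<psi> = \<phi>' + (\<alpha>x + \<beta>)\<phi>\<close>; it vanishes for all \<open>n\<close> iff \<open>\<psi> = 0\<close>, that is, iff \<open>\<phi>\<close> is Gaussian,
  and since \<open>P\<^sub>n' = n P\<^sub>n\<^sub>-\<^sub>1\<close> it is then the claimed recurrence.
  If \<open>P\<close> is orthogonal for \<open>L\<close>, then \<open>\<alpha>\<close> and \<open>\<beta>\<close> can be chosen so that
  orthogonality to \<open>P\<^sub>0\<close> and \<open>P\<^sub>1\<close> gives \<open>L(\<psi>(D)x\<^sup>n) = 0\<close> for all \<open>n\<close>; if the coefficients of
  \<open>\<psi>\<close> below \<open>n\<close> vanish, \<open>\<psi>(D)x\<^sup>n\<close> is the constant \<open>n! \<psi>\<^sub>n\<close>, so \<open>\<psi> = 0\<close> by induction.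
  Conversely, let \<open>L\<close> have the moment generating function \<open>exp(\<alpha>x\<^sup>2/2 + \<beta>x)\<close>. Then
  \<open>L(x f) = L(\<beta>f + \<alpha>f')\<close>, and iterating gives
  \<open>L(P\<^sub>n g) = \<alpha>\<^sup>n \<phi>(0) L(g\<^sup>(\<^sup>n\<^sup>))\<close>, from which orthogonality is read off.\<close>

section \<open>Appell polynomials of a power series and their three-term defect\<close>

definition appell_poly :: "complex fps \<Rightarrow> nat \<Rightarrow> complex poly" where
  "appell_poly \<phi> n = fps_diff_op \<phi> (monom 1 n)"

text \<open>Only \<open>k = n - j\<close> contributes, since the \<open>k\<close>-th derivative of
  \<open>x^n\<close> is a multiple of \<open>x^(n-k)\<close>.\<close>

lemma coeff_appell_poly:
  "coeff (appell_poly \<phi> n) j = (if j \<le> n then fact n / fact j * fps_nth \<phi> (n - j) else 0)"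
proof -
  have "coeff (appell_poly \<phi> n) j
        = (\<Sum>k\<le>n. fps_nth \<phi> k * coeff ((pderiv ^^ k) (monom 1 n)) j)"
    by (simp add: appell_poly_def fps_diff_op_def degree_monom_eq coeff_sum)
  also have "\<dots> = (\<Sum>k\<le>n. if k = n - j \<and> j \<le> n then fps_nth \<phi> k * pochhammer (of_nat (Suc j)) k else 0)"
    by (intro sum.cong refl) (auto simp: coeff_higher_pderiv)
  also have "\<dots> = (if j \<le> n then fps_nth \<phi> (n - j) * pochhammer (of_nat (Suc j)) (n - j) else 0)"
    by simp
  also have "\<dots> = (if j \<le> n then fact n / fact j * fps_nth \<phi> (n - j) else 0)"
  proof (cases "j \<le> n")
    case True
    have "(fact n :: complex) = pochhammer 1 (j + (n - j))"
      using True by (simp add: pochhammer_fact)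
    also have "\<dots> = fact j * pochhammer (of_nat (Suc j)) (n - j)"
      by (subst pochhammer_product') (simp add: pochhammer_fact)
    finally show ?thesis by simp
  qed simp
  finally show ?thesis .
qed

lemma degree_appell_poly_le: "degree (appell_poly \<phi> n) \<le> n"
  by (rule degree_le) (simp add: coeff_appell_poly)

lemma degree_appell_poly:
  assumes "fps_nth \<phi> 0 \<noteq> 0"
  shows "degree (appell_poly \<phi> n) = n"
  using assms by (intro antisym degree_appell_poly_le le_degree) (simp add: coeff_appell_poly)

lemma appell_poly_0: "appell_poly \<phi> 0 = [:fps_nth \<phi> 0:]"
  by (rule poly_eqI) (auto simp: coeff_appell_poly coeff_pCons split: nat.splits)

lemma appell_poly_1: "appell_poly \<phi> (Suc 0) = [:fps_nth \<phi> 1, fps_nth \<phi> 0:]"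
  by (rule poly_eqI) (auto simp: coeff_appell_poly coeff_pCons split: nat.splits)

lemma pderiv_appell_poly:
  "pderiv (appell_poly \<phi> n) = of_nat n * appell_poly \<phi> (n - 1)"
proof (cases n)
  case 0
  then show ?thesis by (simp add: appell_poly_0)
next
  case (Suc m)
  show ?thesis
    by (rule poly_eqI)
       (auto simp: Suc coeff_pderiv coeff_appell_poly of_nat_poly divide_simps
             simp del: of_nat_Suc)
qed

lemma higher_pderiv_appell_poly:
  "(pderiv ^^ n) (appell_poly \<phi> n) = [:fact n * fps_nth \<phi> 0:]"
proof (induction n)
  case (Suc n)
  then show ?case
    by (simp add: funpow_Suc_right pderiv_appell_poly of_nat_poly higher_pderiv_smult
             del: funpow.simps of_nat_Suc)
qed (simp add: appell_poly_0)

text \<open>The commutator of \<phi>(D) with multiplication by \<open>x\<close> is \<phi>'(D), and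
  the remaining terms are already series in \<open>D\<close> applied to \<open>x^n\<close>. The
  proof checks this coefficientwise.\<close>

lemma appell_poly_three_term_defect:
  "appell_poly \<phi> (Suc n) - [:- \<beta>, 1:] * appell_poly \<phi> n + smult \<alpha> (pderiv (appell_poly \<phi> n))
   = appell_poly (fps_deriv \<phi> + (fps_const \<alpha> * fps_X + fps_const \<beta>) * \<phi>) n"
proof (rule poly_eqI)
  fix j
  \<comment> \<open>In the generic last case \<open>n - j = m + 1\<close>, so exactly the
    coefficients \<open>m\<close>, \<open>m + 1\<close> and \<open>m + 2\<close> of \<phi> occur.
    For \<open>j = n\<close> the \<alpha>-term is absent, and for \<open>j = n + 1\<close> the
    leading terms cancel.\<close>
  consider "n + 1 < j" | "j = n + 1" | "j = n" | m where "n = Suc (j + m)"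
    by (metis Suc_eq_plus1 less_iff_Suc_add linorder_neqE_nat not_less_eq add_Suc_right)
  then show "coeff (appell_poly \<phi> (Suc n) - [:- \<beta>, 1:] * appell_poly \<phi> n
                    + smult \<alpha> (pderiv (appell_poly \<phi> n))) j
    = coeff (appell_poly (fps_deriv \<phi> + (fps_const \<alpha> * fps_X + fps_const \<beta>) * \<phi>) n) j"
  proof cases
    case 4
    define c :: complex where "c = fact n / fact j"
    \<comment> \<open>This is the \<phi>' part: \<open>(n+1)!/j! - n!/(j-1)!\<close> equals
      \<open>n!/j! * (n+1-j)\<close>, and \<open>n+1-j = m+2\<close>.\<close>
    have "coeff (appell_poly \<phi> (Suc n) - pCons 0 (appell_poly \<phi> n)) j
          = c * (of_nat (Suc (Suc m)) * fps_nth \<phi> (Suc (Suc m)))"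
    proof (cases j)
      case 0
      then show ?thesis using 4 by (simp add: c_def coeff_appell_poly)
    next
      case (Suc i)
      have "fact (Suc n) / fact (Suc i) - fact n / fact i
            = fact n / fact (Suc i) * (of_nat (Suc n) - of_nat (Suc i) :: complex)"
        by (simp add: divide_simps del: of_nat_Suc) (simp add: algebra_simps)
      then have "(fact (Suc n) / fact (Suc i) - fact n / fact i) * x
            = fact n / fact (Suc i) * (of_nat (Suc (Suc m)) * x)" for x :: complex
        using 4 Suc by simp
      then show ?thesis using 4 Suc by (simp add: c_def coeff_appell_poly left_diff_distrib)
    qed
    moreover have "coeff (pderiv (appell_poly \<phi> n)) j = c * fps_nth \<phi> m"
      using 4 by (simp add: c_def coeff_pderiv coeff_appell_poly divide_simps del: of_nat_Suc)
    moreover have "coeff (appell_poly \<phi> n) j = c * fps_nth \<phi> (Suc m)"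
      using 4 by (simp add: c_def coeff_appell_poly)
    moreover have "coeff (appell_poly (fps_deriv \<phi> + (fps_const \<alpha> * fps_X + fps_const \<beta>) * \<phi>) n) j
      = c * (of_nat (Suc (Suc m)) * fps_nth \<phi> (Suc (Suc m))
          + (\<alpha> * fps_nth \<phi> m + \<beta> * fps_nth \<phi> (Suc m)))"
      using 4 by (simp add: c_def coeff_appell_poly distrib_right mult.assoc)
    moreover have "coeff (appell_poly \<phi> (Suc n) - [:- \<beta>, 1:] * appell_poly \<phi> n
          + smult \<alpha> (pderiv (appell_poly \<phi> n))) j
        = coeff (appell_poly \<phi> (Suc n) - pCons 0 (appell_poly \<phi> n)) j
          + (\<alpha> * coeff (pderiv (appell_poly \<phi> n)) j + \<beta> * coeff (appell_poly \<phi> n) j)"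
      by simp
    ultimately show ?thesis
      by (simp only:) (simp add: algebra_simps)
  next
    case 3
    have ratio: "fact (Suc k) / fact k = (of_nat (Suc k) :: complex)" for k
      by simp
    from 3 show ?thesis
      by (cases n) (simp_all add: coeff_appell_poly coeff_pderiv distrib_right mult.assoc ratio
        del: fact_Suc)
  next
    case 2
    then show ?thesis
      by (simp add: coeff_appell_poly coeff_pderiv del: fact_Suc)
  next
    case 1
    then obtain i where "j = Suc i" "n < i" by (cases j) auto
    then show ?thesis
      by (simp add: coeff_appell_poly coeff_pderiv)
  qed
qed

lemma appell_poly_Suc:
  assumes "fps_deriv \<phi> + (fps_const \<alpha> * fps_X + fps_const \<beta>) * \<phi> = 0"
  shows "appell_poly \<phi> (Suc n)
    = [:- \<beta>, 1:] * appell_poly \<phi> n - smult \<alpha> (pderiv (appell_poly \<phi> n))"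
proof -
  have "appell_poly 0 n = 0" by (rule poly_eqI) (simp add: coeff_appell_poly)
  then show ?thesis
    using appell_poly_three_term_defect[of \<phi> n \<beta> \<alpha>] unfolding assms
    by (simp add: algebra_simps)
qed

section \<open>Formal Gaussians as solutions of a linear differential equation\<close>

text \<open>Coefficient \<open>m\<close> of \<open>h * f\<close> involves \<open>f\<close> only up
  to index \<open>m\<close>, so the equation determines coefficient \<open>m + 1\<close> after
  division by \<open>m + 1\<close>.\<close>

lemma fps_linear_ode_unique:
  fixes f g h :: "'a::field_char_0 fps"
  assumes "fps_deriv f = h * f" "fps_deriv g = h * g" "fps_nth f 0 = fps_nth g 0"
  shows "f = g"
proof (rule fps_ext)
  fix n
  show "fps_nth f n = fps_nth g n"
  proof (induction n rule: less_induct)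
    case (less n)
    show ?case
    proof (cases n)
      case (Suc m)
      have "fps_nth (h * f) m = fps_nth (h * g) m"
        unfolding fps_mult_nth using less Suc by (intro sum.cong) auto
      then have "of_nat (Suc m) * fps_nth f (Suc m) = of_nat (Suc m) * fps_nth g (Suc m)"
        using assms(1,2) by (metis fps_deriv_nth Suc_eq_plus1)
      then show ?thesis
        using Suc by (simp del: of_nat_Suc)
    qed (use assms in simp)
  qed
qed

lemma fps_deriv_exp_compose:
  fixes g :: "'a::field_char_0 fps"
  assumes "fps_nth g 0 = 0"
  shows "fps_deriv (fps_compose (fps_exp 1) g) = fps_deriv g * fps_compose (fps_exp 1) g"
  using assms by (simp add: fps_compose_deriv mult.commute)

lemma fps_gaussian_iff:
  fixes \<phi> :: "'a::field_char_0 fps"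
  shows "\<phi> = fps_const c *
           fps_compose (fps_exp 1) (- fps_const (\<alpha> / 2) * fps_X\<^sup>2 - fps_const \<beta> * fps_X)
     \<longleftrightarrow> fps_nth \<phi> 0 = c \<and>
         fps_deriv \<phi> + (fps_const \<alpha> * fps_X + fps_const \<beta>) * \<phi> = 0"
    (is "_ = ?E \<longleftrightarrow> _")
proof -
  let ?g = "- fps_const (\<alpha> / 2) * fps_X\<^sup>2 - fps_const \<beta> * fps_X"
  let ?h = "- (fps_const \<alpha> * fps_X + fps_const \<beta>)"
  have "fps_deriv ?g = ?h"
    by (simp add: fps_deriv_power numeral_fps_const flip: mult.assoc)
  then have E: "fps_deriv ?E = ?h * ?E" "fps_nth ?E 0 = c"
    using fps_deriv_exp_compose[of ?g] by (simp_all add: power2_eq_square mult.assoc mult.left_commute)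
  have "fps_deriv \<phi> + (fps_const \<alpha> * fps_X + fps_const \<beta>) * \<phi> = 0 \<longleftrightarrow> fps_deriv \<phi> = ?h * \<phi>"
    by (simp add: eq_neg_iff_add_eq_0 del: minus_add_distrib)
  with E show ?thesis
    using fps_linear_ode_unique[of \<phi> ?h ?E] by auto
qed

section \<open>Moment functionals and functionals with prescribed moments\<close>

definition moment_map :: "(nat \<Rightarrow> complex) \<Rightarrow> complex poly \<Rightarrow> complex" where
  "moment_map m p = (\<Sum>i\<le>degree p. coeff p i * m i)"

text \<open>Padding with zero coefficients gives polynomials of different degrees a common summation
  range.\<close>

lemma moment_map_eq: "degree p \<le> n \<Longrightarrow> moment_map m p = (\<Sum>i\<le>n. coeff p i * m i)"
  unfolding moment_map_def by (rule sum.mono_neutral_left) (auto simp: coeff_eq_0)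

lemma moment_map_add: "moment_map m (p + q) = moment_map m p + moment_map m q"
  using moment_map_eq[of p "max (degree p) (degree q)"] moment_map_eq[of q "max (degree p) (degree q)"]
    moment_map_eq[of "p + q" "max (degree p) (degree q)"]
  by (simp add: degree_add_le_max sum.distrib distrib_right)

lemma moment_map_smult: "moment_map m (smult c p) = c * moment_map m p"
  using moment_map_eq[of "smult c p" "degree p"]
  by (simp add: degree_smult_le moment_map_def sum_distrib_left mult.assoc)

lemma vector_space_smult: "vector_space (smult :: 'a::field \<Rightarrow> _)"
  by unfold_locales (simp_all add: smult_add_right smult_add_left)

lemma moment_functional_iff:
  "moment_functional L \<longleftrightarrow>
     (\<forall>p q. L (p + q) = L p + L q) \<and> (\<forall>c p. L (smult c p) = c * L p)"
proof -
  have "vector_space ((*) :: complex \<Rightarrow> _)"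
    by unfold_locales (simp_all add: algebra_simps)
  then show ?thesis
    by (simp add: moment_functional_def Vector_Spaces.linear_iff vector_space_smult)
qed

lemma moment_functional_moment_map: "moment_functional (moment_map m)"
  by (simp add: moment_functional_iff moment_map_add moment_map_smult)

context
  fixes L :: "complex poly \<Rightarrow> complex"
  assumes L: "moment_functional L"
begin

lemma moment_functional_add: "L (p + q) = L p + L q"
  and moment_functional_smult: "L (smult c p) = c * L p"
  using L by (simp_all add: moment_functional_iff)

lemma moment_functional_0: "L 0 = 0"
  using moment_functional_smult[of 0 0] by simp

lemma moment_functional_diff: "L (p - q) = L p - L q"
  using moment_functional_add[of "p - q" q] by simp

lemma moment_functional_const: "L [:c:] = c * L 1"
  using moment_functional_smult[of c 1] by simp

section \<open>From orthogonality to the differential equation, and the adjoint action of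
  \<open>P\<^sub>n\<close>\<close>

lemma appell_orthogonal_imp_ode:
  assumes \<phi>0: "fps_nth \<phi> 0 \<noteq> 0" and L1: "L 1 \<noteq> 0"
    and P_0: "\<And>n. n \<ge> 1 \<Longrightarrow> L (appell_poly \<phi> n) = 0"
    and P_1: "\<And>n. n \<ge> 2 \<Longrightarrow> L (appell_poly \<phi> 1 * appell_poly \<phi> n) = 0"
    and P_11: "L ((appell_poly \<phi> 1)\<^sup>2) \<noteq> 0"
  obtains \<alpha> \<beta> where "\<alpha> \<noteq> 0"
    "fps_deriv \<phi> + (fps_const \<alpha> * fps_X + fps_const \<beta>) * \<phi> = 0"
proof -
  define a where "a = fps_nth \<phi> 0"
  \<comment> \<open>\<beta> is the root of \<open>P\<^sub>1\<close>, so that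
    \<open>x - \<beta>\<close> is a multiple of \<open>P\<^sub>1\<close>; \<alpha> is the value
    forced by \<open>L(\<psi>(D)x) = 0\<close>.\<close>
  define \<beta> where "\<beta> = - fps_nth \<phi> 1 / a"
  define \<alpha> where "\<alpha> = L ((appell_poly \<phi> 1)\<^sup>2) / (a\<^sup>2 * L 1)"
  define \<psi> where "\<psi> = fps_deriv \<phi> + (fps_const \<alpha> * fps_X + fps_const \<beta>) * \<phi>"
  have a: "a \<noteq> 0" using \<phi>0 by (simp add: a_def)
  have "[:- \<beta>, 1:] = smult (1 / a) (appell_poly \<phi> 1)"
    using a by (simp add: \<beta>_def appell_poly_1 flip: a_def)
  then have L\<psi>_eq: "L (appell_poly \<psi> n) = L (appell_poly \<phi> (Suc n))
      - L (appell_poly \<phi> 1 * appell_poly \<phi> n) / a + \<alpha> * of_nat n * L (appell_poly \<phi> (n - 1))" for n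
    unfolding \<psi>_def appell_poly_three_term_defect[symmetric]
    by (simp add: moment_functional_add moment_functional_diff moment_functional_smult
          pderiv_appell_poly of_nat_poly)
  have L\<psi>: "L (appell_poly \<psi> n) = 0" for n
  proof -
    consider "n = 0" | "n = 1" | "n \<ge> 2" by linarith
    then show ?thesis
    proof cases
      case 1
      then show ?thesis
        using P_0[of 1] by (simp only: L\<psi>_eq) (simp add: appell_poly_0 moment_functional_smult)
    next
      case 2
      have "L (appell_poly \<phi> 0) = a * L 1"
        by (simp add: appell_poly_0 moment_functional_const a_def)
      \<comment> \<open>As \<open>L(P\<^sub>2) = 0\<close>, what remains is
        \<open>- L(P\<^sub>1^2) / a + \<alpha> * a * L 1\<close>, which is zero by the choice of
        \<alpha>.\<close>
      then show ?thesis
        using 2 P_0[of 2] a L1 by (simp add: L\<psi>_eq \<alpha>_def power2_eq_square numeral_2_eq_2)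
    next
      case 3
      then show ?thesis using P_0 P_1 by (simp add: L\<psi>_eq)
    qed
  qed
  have "fps_nth \<psi> n = 0" for n
  proof (induction n rule: less_induct)
    case (less n)
    have "appell_poly \<psi> n = [:fact n * fps_nth \<psi> n:]"
      by (rule poly_eqI) (auto simp: coeff_appell_poly coeff_pCons less split: nat.splits)
    then show ?case
      using L\<psi>[of n] L1 by (simp add: moment_functional_const)
  qed
  then have "\<psi> = 0" by (simp add: fps_eq_iff)
  moreover have "\<alpha> \<noteq> 0" using P_11 a L1 by (simp add: \<alpha>_def)
  ultimately show thesis using that by (simp add: \<psi>_def)
qed

text \<open>The hypothesis on \<open>L\<close> is Gaussian integration by parts; it moves the \<open>n\<close> lowering
  steps of the recurrence onto \<open>g\<close>.\<close>

lemma moment_functional_appell_mult: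
  assumes ibp: "\<And>f. L (pCons 0 f) = \<beta> * L f + \<alpha> * L (pderiv f)"
    and rec: "\<And>n. appell_poly \<phi> (Suc n)
               = [:- \<beta>, 1:] * appell_poly \<phi> n - smult \<alpha> (pderiv (appell_poly \<phi> n))"
  shows "L (appell_poly \<phi> n * g) = \<alpha> ^ n * fps_nth \<phi> 0 * L ((pderiv ^^ n) g)"
proof (induction n arbitrary: g)
  case 0
  then show ?case by (simp add: appell_poly_0 moment_functional_smult)
next
  case (Suc n)
  let ?A = "appell_poly \<phi> n"
  have "appell_poly \<phi> (Suc n) * g
        = pCons 0 (?A * g) - smult \<beta> (?A * g) - smult \<alpha> (pderiv ?A * g)"
    by (simp add: rec algebra_simps)
  \<comment> \<open>Integration by parts applied to \<open>?A * g\<close> cancels the \<beta>-terms;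
    by the product rule the term with \<open>pderiv ?A\<close> cancels too.\<close>
  also have "L \<dots> = \<alpha> * L (?A * pderiv g)"
    by (simp add: moment_functional_diff moment_functional_smult ibp pderiv_mult
          moment_functional_add algebra_simps)
  finally show ?case by (simp add: Suc funpow_swap1)
qed

end

section \<open>The Gaussian functional and sufficiency\<close>

text \<open>On \<open>f = x^k\<close> the identity is the assumed recursion for the moments, and
  both sides are linear in \<open>f\<close>. At \<open>k = 0\<close> the truncated
  \<open>m (k - 1)\<close> carries the factor 0.\<close>

lemma moment_map_pCons_0:
  assumes "\<And>k. m (Suc k) = \<beta> * m k + \<alpha> * of_nat k * m (k - 1)"
  shows "moment_map m (pCons 0 f) = \<beta> * moment_map m f + \<alpha> * moment_map m (pderiv f)"
proof -
  define d where "d = degree f"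
  have "moment_map m (pCons 0 f) = (\<Sum>i\<le>Suc d. coeff (pCons 0 f) i * m i)"
    by (rule moment_map_eq) (simp add: d_def degree_pCons_le)
  also have "\<dots> = (\<Sum>i\<le>d. coeff f i * m (Suc i))"
    by (simp add: sum.atMost_Suc_shift del: sum.atMost_Suc)
  also have "\<dots> = \<beta> * (\<Sum>i\<le>d. coeff f i * m i) + \<alpha> * (\<Sum>i\<le>d. of_nat i * coeff f i * m (i - 1))"
    by (simp add: assms sum_distrib_left algebra_simps flip: sum.distrib)
  \<comment> \<open>The added term is zero; it lets the index shift, whose term at 0 vanishes,
    produce the coefficients of \<open>pderiv f\<close>.\<close>
  also have "(\<Sum>i\<le>d. of_nat i * coeff f i * m (i - 1))
             = (\<Sum>i\<le>Suc d. of_nat i * coeff f i * m (i - 1))"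
    by (simp add: d_def coeff_eq_0)
  also have "\<dots> = (\<Sum>i\<le>d. coeff (pderiv f) i * m i)"
    by (simp add: sum.atMost_Suc_shift coeff_pderiv del: sum.atMost_Suc)
  also have "\<dots> = moment_map m (pderiv f)"
    by (rule moment_map_eq[symmetric]) (simp add: degree_pderiv d_def)
  finally show ?thesis by (simp add: moment_map_def d_def)
qed

lemma is_OPS_appell_poly:
  assumes \<alpha>: "\<alpha> \<noteq> 0" and \<phi>0: "fps_nth \<phi> 0 \<noteq> 0"
    and ode: "fps_deriv \<phi> + (fps_const \<alpha> * fps_X + fps_const \<beta>) * \<phi> = 0"
  shows "is_OPS (appell_poly \<phi>)"
proof -
  \<comment> \<open>\<open>w\<close> is \<open>exp(\<alpha>x^2/2 + \<beta>x)\<close>, written with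
    negated parameters to match \<open>fps_gaussian_iff\<close>; as an exponential generating
    function it has the moments \<open>m k\<close>.\<close>
  define w :: "complex fps" where
    "w = fps_const 1 *
       fps_compose (fps_exp 1) (- fps_const (- \<alpha> / 2) * fps_X\<^sup>2 - fps_const (- \<beta>) * fps_X)"
  define m where "m = (\<lambda>k. fact k * fps_nth w k)"
  define L where "L = moment_map m"
  have w: "fps_nth w 0 = 1" "fps_deriv w + (fps_const (- \<alpha>) * fps_X + fps_const (- \<beta>)) * w = 0"
    using fps_gaussian_iff[of w 1 "- \<alpha>" "- \<beta>"] w_def by blast+
  \<comment> \<open>Coefficient \<open>k\<close> of \<open>w' = (\<alpha>x + \<beta>)w\<close>,
    multiplied by \<open>k!\<close>.\<close>
  have m: "m (Suc k) = \<beta> * m k + \<alpha> * of_nat k * m (k - 1)" for k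
  proof -
    have "fps_nth (fps_deriv w + (fps_const (- \<alpha>) * fps_X + fps_const (- \<beta>)) * w) k = 0"
      by (simp only: w fps_zero_nth)
    then have "of_nat (Suc k) * fps_nth w (Suc k)
               = \<beta> * fps_nth w k + \<alpha> * (if k = 0 then 0 else fps_nth w (k - 1))"
      by (cases k) (simp_all add: algebra_simps)
    then have "fact k * (of_nat (Suc k) * fps_nth w (Suc k))
               = fact k * (\<beta> * fps_nth w k + \<alpha> * (if k = 0 then 0 else fps_nth w (k - 1)))"
      by (simp only:)
    then show ?thesis
      by (cases k) (simp_all add: m_def algebra_simps)
  qed
  have L: "moment_functional L"
    by (simp add: L_def moment_functional_moment_map)
  have Lmult: "L (appell_poly \<phi> n * g) = \<alpha> ^ n * fps_nth \<phi> 0 * L ((pderiv ^^ n) g)" for n g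
    using L moment_map_pCons_0[of m, OF m] appell_poly_Suc[OF ode] unfolding L_def
    by (intro moment_functional_appell_mult) auto
  \<comment> \<open>With the larger index moved onto the other factor, \<open>n\<close> derivatives
    annihilate a polynomial of degree at most \<open>k < n\<close>.\<close>
  have less: "L (appell_poly \<phi> n * appell_poly \<phi> k) = 0" if "k < n" for k n
  proof -
    have "(pderiv ^^ n) (appell_poly \<phi> k) = 0"
      using that by (intro poly_eqI) (simp add: coeff_higher_pderiv coeff_appell_poly)
    then show ?thesis using L by (simp add: Lmult moment_functional_0)
  qed
  have "L 1 = 1" by (simp add: L_def moment_map_def m_def w)
  then have "L ((appell_poly \<phi> n)\<^sup>2) \<noteq> 0" for n
    using L \<alpha> \<phi>0
    by (simp add: power2_eq_square Lmult higher_pderiv_appell_poly moment_functional_const)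
  moreover have "L (appell_poly \<phi> k * appell_poly \<phi> n) = 0" if "k \<noteq> n" for k n
    using less[of k n] less[of n k] that by (metis linorder_neqE_nat mult.commute)
  moreover have "appell_poly \<phi> n \<noteq> 0" for n
    using \<phi>0 by (auto simp: poly_eq_iff coeff_appell_poly intro!: exI[of _ n])
  ultimately show ?thesis
    using L degree_appell_poly[OF \<phi>0] by (auto simp: is_OPS_def intro!: exI[of _ L])
qed

section \<open>The characterization and the recurrence\<close>

lemma is_OPS_appell_poly_iff:
  "is_OPS (appell_poly \<phi>) \<longleftrightarrow>
     (\<exists>\<alpha> \<beta>. \<alpha> \<noteq> 0 \<and> fps_nth \<phi> 0 \<noteq> 0 \<and>
        fps_deriv \<phi> + (fps_const \<alpha> * fps_X + fps_const \<beta>) * \<phi> = 0)"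
proof
  assume "is_OPS (appell_poly \<phi>)"
  then obtain L where L: "moment_functional L"
    and nz: "\<And>n. appell_poly \<phi> n \<noteq> 0"
    and orth: "\<And>k n. k \<noteq> n \<Longrightarrow> L (appell_poly \<phi> k * appell_poly \<phi> n) = 0"
    and sq: "\<And>n. L ((appell_poly \<phi> n)\<^sup>2) \<noteq> 0"
    by (auto simp: is_OPS_def)
  have \<phi>0: "fps_nth \<phi> 0 \<noteq> 0"
    using nz[of 0] by (simp add: appell_poly_0)
  \<comment> \<open>\<open>P\<^sub>0\<close> is constant, so \<open>L(P\<^sub>0^2)\<close> is a
    multiple of \<open>L 1\<close>.\<close>
  have "L 1 \<noteq> 0"
    using sq[of 0] L by (auto simp: appell_poly_0 power2_eq_square moment_functional_const)
  moreover have "L (appell_poly \<phi> n) = 0" if "n \<ge> 1" for n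
    using orth[of 0 n] that \<phi>0 L by (simp add: appell_poly_0 moment_functional_smult)
  ultimately obtain \<alpha> \<beta> where "\<alpha> \<noteq> 0"
    "fps_deriv \<phi> + (fps_const \<alpha> * fps_X + fps_const \<beta>) * \<phi> = 0"
    using L \<phi>0 orth sq by (elim appell_orthogonal_imp_ode[of L \<phi>]) auto
  with \<phi>0 show "\<exists>\<alpha> \<beta>. \<alpha> \<noteq> 0 \<and> fps_nth \<phi> 0 \<noteq> 0 \<and>
        fps_deriv \<phi> + (fps_const \<alpha> * fps_X + fps_const \<beta>) * \<phi> = 0"
    by blast
qed (use is_OPS_appell_poly in blast)

theorem theorem2p3:
  fixes \<gamma> :: "nat \<Rightarrow> complex"
    and \<phi> :: "complex fps"
    and P :: "nat \<Rightarrow> complex poly"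
  assumes phi: "\<phi> = Abs_fps (\<lambda>k. \<gamma> k / fact k)"
    and P: "\<And>n. P n = fps_diff_op \<phi> (monom 1 n)"
  shows "(is_OPS P \<longleftrightarrow>
            (\<exists>\<alpha> \<beta>. \<alpha> \<noteq> 0 \<and> \<gamma> 0 \<noteq> 0 \<and>
               \<phi> = fps_const (\<gamma> 0) *
                   fps_compose (fps_exp 1) (- fps_const (\<alpha> / 2) * fps_X\<^sup>2 - fps_const \<beta> * fps_X)))
       \<and> (\<forall>\<alpha> \<beta>. \<alpha> \<noteq> 0 \<and> \<gamma> 0 \<noteq> 0 \<and>
               \<phi> = fps_const (\<gamma> 0) *
                   fps_compose (fps_exp 1) (- fps_const (\<alpha> / 2) * fps_X\<^sup>2 - fps_const \<beta> * fps_X)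
            \<longrightarrow> P 0 = [:\<gamma> 0:] \<and>
                (\<forall>n\<ge>1. P n = [:- \<beta>, 1:] * P (n - 1)
                              - smult (\<alpha> * of_nat (n - 1)) (if n = 1 then 0 else P (n - 2))))"
proof -
  have P_eq: "P = appell_poly \<phi>"
    by (simp add: fun_eq_iff P appell_poly_def)
  have \<gamma>0: "fps_nth \<phi> 0 = \<gamma> 0" by (simp add: phi)
  \<comment> \<open>The last term is \<alpha> times the derivative of
    \<open>P\<^sub>n\<^sub>-\<^sub>1\<close>; for \<open>n = 1\<close> this derivative is 0, in
    accordance with \<open>P\<^sub>-\<^sub>1 = 0\<close>.\<close>
  have "P n = [:- \<beta>, 1:] * P (n - 1) - smult (\<alpha> * of_nat (n - 1)) (if n = 1 then 0 else P (n - 2))"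
    if "fps_deriv \<phi> + (fps_const \<alpha> * fps_X + fps_const \<beta>) * \<phi> = 0" "n \<ge> 1" for \<alpha> \<beta> n
  proof -
    obtain k where k: "n = Suc k" using \<open>n \<ge> 1\<close> by (cases n) auto
    show ?thesis
      using appell_poly_Suc[OF that(1), of k] k
      by (simp add: P_eq pderiv_appell_poly of_nat_poly)
  qed
  then show ?thesis
    unfolding fps_gaussian_iff by (auto simp: P_eq is_OPS_appell_poly_iff \<gamma>0 appell_poly_0)
qed

end
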